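(* Let $X$ be a $T_0$ space. The following conditions are equivalent: (1) $X$ is a continuous space; (2) the map $\bigvee: {\rm I}_T(X)\to X$, $A\mapsto \bigvee A$, has a continuous lower adjoint, i.e. there is a continuous map $f:X\to {\rm I}_T(X)$ such that for all $x\in X$ and $A\in {\rm I}_T(X)$: $f(x)\subseteq A \Leftrightarrow x\sqsubseteq \bigvee A$; (3) $X$ is a continuous retract of some algebraic space, i.e. there are an algebraic space $Y$ and continuous maps $g:X\to Y$, $h:Y\to X$ with $h\circ g=\mathrm{id}_X$.
   Context: All order notions on a $T_0$ space $X$ refer to the specialization order: $x\sqsubseteq y$ iff $x\in\overline{\{y\}}$. $\downarrow x=\{y: y\sqsubseteq x\}$, $\uparrow x=\{y: x\sqsubseteq y\}$; $(\cdot)^\circ$ is interior. Directed sets are nonempty. A directed set $D\subseteq X$ converges to $x$ ($D\to x$) if $D$ meets every open neighbourhood of $x$. Continuous space: a $T_0$ space that is a c-space, i.e. for every open $U$ and $y\in U$ there is $x\in U$ with $y\in(\uparrow x)^\circ$. Algebraic space: a $T_0$ space that is a b-space, i.e. for every open $U$ and $x\in U$ there is $y\in U$ with $x\in(\uparrow y)^\circ=\uparrow y$. Topological ideals: a directed subset $D\subseteq X$ is an ideal net if there is $x\in X$ with $D\to x$ and $d\sqsubseteq x$ for all $d\in D$ (then $x=\bigvee D$). A subset $A\subseteq X$ is a topological ideal if $A=\downarrow D$ for some ideal net $D$; equivalently, $A$ is a directed lower set which has a supremum $\bigvee A$ and converges to it. ${\rm I}_T(X)$ is the set of all topological ideals of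 $X$, equipped with the topology $$\Omega({\rm I}_T(X))=\{\mathcal U\subseteq {\rm I}_T(X): \text{for all } A\in {\rm I}_T(X),\ A\in\mathcal U\Leftrightarrow \exists x\in X\ (\downarrow x\in\mathcal U \text{ and } \downarrow x\subseteq A)\}.$$ Its specialization order is inclusion. *)

theory Defs
  imports "HOL-Analysis.Analysis"
begin

text \<open>
  A space is an abstract topology \<open>X\<close>, whose points are the elements of \<open>topspace X\<close>.
  Since \<open>X closure_of {y}\<close> is empty for \<open>y \<notin> topspace X\<close>, the relation \<open>spec_le X\<close>
  only relates points of \<open>X\<close>; so the sets \<open>down X x\<close>, \<open>up X x\<close> and \<open>down_set X D\<close>
  are subsets of \<open>topspace X\<close>.
\<close>

definition spec_le :: "'a topology \<Rightarrow> 'a \<Rightarrow> 'a \<Rightarrow> bool"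
  where "spec_le X x y \<longleftrightarrow> x \<in> X closure_of {y}"

definition down :: "'a topology \<Rightarrow> 'a \<Rightarrow> 'a set"
  where "down X x = {y. spec_le X y x}"

definition up :: "'a topology \<Rightarrow> 'a \<Rightarrow> 'a set"
  where "up X x = {y. spec_le X x y}"

definition down_set :: "'a topology \<Rightarrow> 'a set \<Rightarrow> 'a set"
  where "down_set X D = (\<Union>d\<in>D. down X d)"

definition directed :: "'a topology \<Rightarrow> 'a set \<Rightarrow> bool"
  where "directed X D \<longleftrightarrow> D \<noteq> {} \<and> D \<subseteq> topspace X \<and>
    (\<forall>x\<in>D. \<forall>y\<in>D. \<exists>z\<in>D. spec_le X x z \<and> spec_le X y z)"

definition dconverges :: "'a topology \<Rightarrow> 'a set \<Rightarrow> 'a \<Rightarrow> bool"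
  where "dconverges X D x \<longleftrightarrow> x \<in> topspace X \<and>
    (\<forall>U. openin X U \<and> x \<in> U \<longrightarrow> D \<inter> U \<noteq> {})"

definition continuous_space :: "'a topology \<Rightarrow> bool"
  where "continuous_space X \<longleftrightarrow> t0_space X \<and>
    (\<forall>U y. openin X U \<and> y \<in> U \<longrightarrow> (\<exists>x\<in>U. y \<in> X interior_of (up X x)))"

definition algebraic_space :: "'a topology \<Rightarrow> bool"
  where "algebraic_space X \<longleftrightarrow> t0_space X \<and>
    (\<forall>U x. openin X U \<and> x \<in> U \<longrightarrow>
      (\<exists>y\<in>U. x \<in> X interior_of (up X y) \<and> X interior_of (up X y) = up X y))"

definition ideal_net :: "'a topology \<Rightarrow> 'a set \<Rightarrow> bool"
  where "ideal_net X D \<longleftrightarrow> directed X D \<and>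
    (\<exists>x\<in>topspace X. dconverges X D x \<and> (\<forall>d\<in>D. spec_le X d x))"

definition top_ideals :: "'a topology \<Rightarrow> 'a set set"
  where "top_ideals X = {A. \<exists>D. ideal_net X D \<and> A = down_set X D}"

definition is_tsup :: "'a topology \<Rightarrow> 'a set \<Rightarrow> 'a \<Rightarrow> bool"
  where "is_tsup X A s \<longleftrightarrow> s \<in> topspace X \<and> (\<forall>a\<in>A. spec_le X a s) \<and>
    (\<forall>u\<in>topspace X. (\<forall>a\<in>A. spec_le X a u) \<longrightarrow> spec_le X s u)"

text \<open>Meaningful for every topological ideal of a \<open>T\<^sub>0\<close> space: see \<open>is_tsup_tsup\<close> below.\<close>

definition tsup :: "'a topology \<Rightarrow> 'a set \<Rightarrow> 'a"
  where "tsup X A = (THE s. is_tsup X A s)"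

definition ideal_open :: "'a topology \<Rightarrow> 'a set set \<Rightarrow> bool"
  where "ideal_open X \<U> \<longleftrightarrow> \<U> \<subseteq> top_ideals X \<and>
    (\<forall>A\<in>top_ideals X. A \<in> \<U> \<longleftrightarrow> (\<exists>x\<in>topspace X. down X x \<in> \<U> \<and> down X x \<subseteq> A))"

text \<open>That \<open>ideal_open X\<close> is indeed a topology, with underlying set \<open>top_ideals X\<close>,
  is shown in \<open>openin_ideal_space\<close> and \<open>topspace_ideal_space\<close> below.\<close>

definition ideal_space :: "'a topology \<Rightarrow> 'a set topology"
  where "ideal_space X = topology (ideal_open X)"

lemma spec_le_iff:
  "spec_le X x y \<longleftrightarrow> x \<in> topspace X \<and> y \<in> topspace X \<and> (\<forall>U. openin X U \<and> x \<in> U \<longrightarrow> y \<in> U)"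
  unfolding spec_le_def closure_of_def by auto

lemma spec_le_refl: "x \<in> topspace X \<Longrightarrow> spec_le X x x"
  by (simp add: spec_le_iff)

lemma spec_le_trans: "spec_le X x y \<Longrightarrow> spec_le X y z \<Longrightarrow> spec_le X x z"
  unfolding spec_le_iff by blast

lemma spec_le_antisym:
  assumes "t0_space X" "spec_le X x y" "spec_le X y x"
  shows "x = y"
proof (rule ccontr)
  assume "x \<noteq> y"
  moreover have "x \<in> topspace X" "y \<in> topspace X"
    using assms(2) by (simp_all add: spec_le_iff)
  ultimately obtain U where "openin X U" "x \<notin> U \<longleftrightarrow> y \<in> U"
    using assms(1) unfolding t0_space_def by metis
  then show False
    using assms(2,3) unfolding spec_le_iff by metis
qed

lemma down_in_top_ideals:
  assumes "x \<in> topspace X"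
  shows "down X x \<in> top_ideals X"
proof -
  have "ideal_net X {x}"
    using assms by (auto simp: ideal_net_def directed_def dconverges_def spec_le_refl)
  moreover have "down X x = down_set X {x}"
    by (simp add: down_set_def)
  ultimately show ?thesis
    unfolding top_ideals_def by blast
qed

lemma is_tsup_unique:
  assumes "t0_space X" "is_tsup X A s" "is_tsup X A t"
  shows "s = t"
  using assms(2,3) spec_le_antisym[OF assms(1), of s t] unfolding is_tsup_def by simp

lemma ideal_net_limit_is_tsup:
  assumes "dconverges X D x" "\<forall>d\<in>D. spec_le X d x"
  shows "is_tsup X (down_set X D) x"
  unfolding is_tsup_def
proof (intro conjI ballI impI)
  show x: "x \<in> topspace X" using assms(1) by (simp add: dconverges_def)
  show "spec_le X a x" if "a \<in> down_set X D" for a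
  proof -
    obtain d where d: "d \<in> D" "spec_le X a d"
      using \<open>a \<in> down_set X D\<close> by (auto simp: down_set_def down_def)
    show ?thesis using spec_le_trans[OF d(2)] assms(2) d(1) by blast
  qed
  fix u assume u: "u \<in> topspace X" "\<forall>a\<in>down_set X D. spec_le X a u"
  have "u \<in> U" if U: "openin X U" "x \<in> U" for U
  proof -
    obtain d where d: "d \<in> D" "d \<in> U"
      using assms(1) U by (auto simp: dconverges_def)
    have "d \<in> down_set X D"
      using d U(1) spec_le_refl[of d X] openin_subset[OF U(1)]
      by (auto simp: down_set_def down_def)
    then show ?thesis using u d U by (meson spec_le_iff)
  qed
  then show "spec_le X x u" using x u by (simp add: spec_le_iff)
qed

lemma is_tsup_tsup:
  assumes "t0_space X" "A \<in> top_ideals X"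
  shows "is_tsup X A (tsup X A)"
proof -
  obtain D x where D: "A = down_set X D" "dconverges X D x" "\<forall>d\<in>D. spec_le X d x"
    using assms(2) unfolding top_ideals_def ideal_net_def by blast
  have s: "is_tsup X A x"
    using ideal_net_limit_is_tsup[OF D(2,3)] D(1) by simp
  show ?thesis
    unfolding tsup_def using s is_tsup_unique[OF assms(1) _ s] by (rule theI)
qed

lemma top_ideals_directed:
  assumes "A \<in> top_ideals X" "a \<in> A" "b \<in> A"
  shows "\<exists>z\<in>A. spec_le X a z \<and> spec_le X b z"
proof -
  obtain D where D: "directed X D" "A = down_set X D"
    using assms(1) by (auto simp: top_ideals_def ideal_net_def)
  then obtain d e where de: "d \<in> D" "spec_le X a d" "e \<in> D" "spec_le X b e"
    using assms by (auto simp: down_set_def down_def)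
  then obtain z where z: "z \<in> D" "spec_le X d z" "spec_le X e z"
    using D(1) unfolding directed_def by meson
  have "spec_le X z z"
    using z(2) by (auto simp: spec_le_iff)
  then have "z \<in> A"
    using z(1) D(2) by (auto simp: down_set_def down_def)
  then show ?thesis
    using spec_le_trans[OF de(2) z(2)] spec_le_trans[OF de(4) z(3)] by blast
qed

lemma top_ideals_lower:
  assumes "A \<in> top_ideals X" "a \<in> A"
  shows "a \<in> topspace X" "down X a \<subseteq> A"
proof -
  obtain D where A: "A = down_set X D"
    using assms(1) by (auto simp: top_ideals_def)
  then obtain d where d: "d \<in> D" "spec_le X a d"
    using assms(2) by (auto simp: down_set_def down_def)
  show "a \<in> topspace X" using d by (simp add: spec_le_iff)
  show "down X a \<subseteq> A"
  proof
    fix y assume "y \<in> down X a"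
    then have "spec_le X y d"
      using d(2) spec_le_trans[of X y a d] by (simp add: down_def)
    then show "y \<in> A" using A d(1) by (auto simp: down_set_def down_def)
  qed
qed

lemma top_ideals_nonempty:
  assumes "A \<in> top_ideals X"
  shows "A \<noteq> {}"
proof -
  obtain D where D: "directed X D" "A = down_set X D"
    using assms by (auto simp: top_ideals_def ideal_net_def)
  then obtain d where d: "d \<in> D" "d \<in> topspace X"
    by (auto simp: directed_def)
  then have "d \<in> A"
    using D(2) spec_le_refl[OF d(2)] by (auto simp: down_set_def down_def)
  then show ?thesis by blast
qed

lemma ideal_openD:
  assumes "ideal_open X \<U>" "A \<in> \<U>"
  obtains x where "x \<in> topspace X" "down X x \<in> \<U>" "down X x \<subseteq> A"
  using assms unfolding ideal_open_def by (metis subsetD)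

lemma ideal_openI:
  assumes "ideal_open X \<U>" "A \<in> top_ideals X" "x \<in> topspace X" "down X x \<in> \<U>" "down X x \<subseteq> A"
  shows "A \<in> \<U>"
  using assms unfolding ideal_open_def by metis

lemma istopology_ideal_open: "istopology (ideal_open X)"
  unfolding istopology_def
proof (intro conjI allI impI)
  fix S T assume S: "ideal_open X S" and T: "ideal_open X T"
  have "A \<in> S \<inter> T \<longleftrightarrow> (\<exists>x\<in>topspace X. down X x \<in> S \<inter> T \<and> down X x \<subseteq> A)"
    if A: "A \<in> top_ideals X" for A
  proof
    assume AST: "A \<in> S \<inter> T"
    obtain x where x: "x \<in> topspace X" "down X x \<in> S" "down X x \<subseteq> A"
      using ideal_openD[OF S] AST by (metis IntD1)
    obtain y where y: "y \<in> topspace X" "down X y \<in> T" "down X y \<subseteq> A"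
      using ideal_openD[OF T] AST by (metis IntD2)
    have "x \<in> A" "y \<in> A"
      using x(3) y(3) spec_le_refl[OF x(1)] spec_le_refl[OF y(1)] by (auto simp: down_def)
    then obtain z where z: "z \<in> A" "spec_le X x z" "spec_le X y z"
      using top_ideals_directed[OF A] by metis
    have zX: "z \<in> topspace X" "down X z \<subseteq> A"
      using top_ideals_lower[OF A z(1)] by simp_all
    have xz: "down X x \<subseteq> down X z" and yz: "down X y \<subseteq> down X z"
      using spec_le_trans[OF _ z(2)] spec_le_trans[OF _ z(3)] by (auto simp: down_def)
    have "down X z \<in> S"
      by (rule ideal_openI[OF S down_in_top_ideals[OF zX(1)] x(1,2) xz])
    moreover have "down X z \<in> T"
      by (rule ideal_openI[OF T down_in_top_ideals[OF zX(1)] y(1,2) yz])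
    ultimately show "\<exists>x\<in>topspace X. down X x \<in> S \<inter> T \<and> down X x \<subseteq> A"
      using zX by (intro bexI[of _ z]) simp_all
  next
    assume "\<exists>x\<in>topspace X. down X x \<in> S \<inter> T \<and> down X x \<subseteq> A"
    then obtain x where x: "x \<in> topspace X" "down X x \<in> S" "down X x \<in> T" "down X x \<subseteq> A"
      by (elim bexE conjE IntE)
    show "A \<in> S \<inter> T"
      using ideal_openI[OF S A x(1,2,4)] ideal_openI[OF T A x(1,3,4)] by simp
  qed
  moreover have "S \<inter> T \<subseteq> top_ideals X"
    using S by (simp add: ideal_open_def le_infI1)
  ultimately show "ideal_open X (S \<inter> T)"
    unfolding ideal_open_def by (intro conjI ballI)
next
  fix \<K> assume K: "\<forall>K\<in>\<K>. ideal_open X K"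
  have "A \<in> \<Union>\<K> \<longleftrightarrow> (\<exists>x\<in>topspace X. down X x \<in> \<Union>\<K> \<and> down X x \<subseteq> A)"
    if A: "A \<in> top_ideals X" for A
  proof
    assume "A \<in> \<Union>\<K>"
    then obtain K' where K': "K' \<in> \<K>" "A \<in> K'" by (rule UnionE)
    then obtain x where "x \<in> topspace X" "down X x \<in> K'" "down X x \<subseteq> A"
      using ideal_openD K by metis
    then show "\<exists>x\<in>topspace X. down X x \<in> \<Union>\<K> \<and> down X x \<subseteq> A"
      using K'(1) by (meson UnionI)
  next
    assume "\<exists>x\<in>topspace X. down X x \<in> \<Union>\<K> \<and> down X x \<subseteq> A"
    then obtain x K' where x: "x \<in> topspace X" "down X x \<subseteq> A" "K' \<in> \<K>" "down X x \<in> K'"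
      by (elim bexE conjE UnionE)
    have "A \<in> K'"
      using ideal_openI[OF _ A x(1,4,2)] K x(3) by simp
    then show "A \<in> \<Union>\<K>"
      using x(3) by (rule UnionI[rotated])
  qed
  moreover have "\<Union>\<K> \<subseteq> top_ideals X"
    using K by (simp add: ideal_open_def Union_least)
  ultimately show "ideal_open X (\<Union>\<K>)"
    unfolding ideal_open_def by (intro conjI ballI)
qed

lemma openin_ideal_space: "openin (ideal_space X) = ideal_open X"
  unfolding ideal_space_def using istopology_ideal_open[of X] by (simp add: topology_inverse')

lemma topspace_ideal_space: "topspace (ideal_space X) = top_ideals X"
proof (rule equalityI)
  show "topspace (ideal_space X) \<subseteq> top_ideals X"
    by (auto simp: topspace_def openin_ideal_space ideal_open_def)
  have "\<exists>x\<in>topspace X. down X x \<in> top_ideals X \<and> down X x \<subseteq> A"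
    if A: "A \<in> top_ideals X" for A
  proof -
    obtain a where a: "a \<in> A"
      using top_ideals_nonempty[OF A] by blast
    have "a \<in> topspace X" "down X a \<subseteq> A"
      using top_ideals_lower[OF A a] by simp_all
    then show ?thesis
      using down_in_top_ideals by (intro bexI[of _ a]) auto
  qed
  then have "openin (ideal_space X) (top_ideals X)"
    by (simp add: openin_ideal_space ideal_open_def)
  then show "top_ideals X \<subseteq> topspace (ideal_space X)"
    by (rule openin_subset)
qed

end

theory Submission
  imports Defs
begin

text \<open>
  If \<open>X\<close> is a continuous space, the points way below \<open>x\<close>, i.e. those \<open>y\<close> with
  \<open>x\<close> in the interior of \<open>up X y\<close>, form a topological ideal with supremum \<open>x\<close>, and
  this ideal is contained in every topological ideal whose supremum dominates \<open>x\<close>; this gives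
  the lower adjoint. Any lower adjoint is a section of the supremum map, which is itself
  continuous, and the ideal space is algebraic because its principal ideals generate
  open principal filters. Finally, algebraic spaces are continuous, and a retraction
  carries the approximating points of \<open>Y\<close> to approximating points of \<open>X\<close>.
\<close>

section \<open>Suprema and limits of topological ideals\<close>

lemma spec_le_continuous_map:
  assumes "continuous_map X Y f" "spec_le X x y"
  shows "spec_le Y (f x) (f y)"
proof -
  have *: "x \<in> topspace X" "y \<in> topspace X" "\<And>U. openin X U \<Longrightarrow> x \<in> U \<Longrightarrow> y \<in> U"
    using assms(2) by (auto simp: spec_le_iff)
  have "f y \<in> V" if V: "openin Y V" "f x \<in> V" for V
    using *(3)[OF openin_continuous_map_preimage[OF assms(1) V(1)]] V(2) *(1) by simp
  then show ?thesis
    using * continuous_map_image_subset_topspace[OF assms(1)] by (auto simp: spec_le_iff)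
qed

lemma down_subset_iff:
  assumes "A \<in> top_ideals X" "x \<in> topspace X"
  shows "down X x \<subseteq> A \<longleftrightarrow> x \<in> A"
proof
  assume "down X x \<subseteq> A"
  then show "x \<in> A" using spec_le_refl[OF assms(2)] by (auto simp: down_def)
qed (rule top_ideals_lower(2)[OF assms(1)])

text \<open>Since \<open>tsup\<close> is a definite description, this is how it gets computed: a
  limit that bounds \<open>D\<close> is a supremum of the generated ideal, and suprema are unique in
  a T0 space.\<close>

lemma ideal_net_limit_eq_tsup:
  assumes "t0_space X" "directed X D" "dconverges X D x" "\<forall>d\<in>D. spec_le X d x"
  shows "down_set X D \<in> top_ideals X" "tsup X (down_set X D) = x"
proof -
  have "ideal_net X D"
    using assms(2-4) unfolding ideal_net_def by (meson dconverges_def)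
  then show I: "down_set X D \<in> top_ideals X"
    unfolding top_ideals_def by blast
  show "tsup X (down_set X D) = x"
    using is_tsup_unique[OF assms(1) is_tsup_tsup[OF assms(1) I]]
      ideal_net_limit_is_tsup[OF assms(3,4)] by blast
qed

lemma tsup_down:
  assumes "t0_space X" "x \<in> topspace X"
  shows "tsup X (down X x) = x"
proof -
  have "directed X {x}" "dconverges X {x} x" "\<forall>d\<in>{x}. spec_le X d x"
    using assms(2) by (auto simp: directed_def dconverges_def spec_le_refl)
  from ideal_net_limit_eq_tsup(2)[OF assms(1) this] show ?thesis
    by (simp add: down_set_def)
qed

text \<open>A generating net lies inside its ideal, so the ideal meets every open set that the net
  meets, and the limit of the net is the supremum of the ideal.\<close>

lemma top_ideals_converge:
  assumes "t0_space X" "A \<in> top_ideals X"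
  shows "dconverges X A (tsup X A)"
proof -
  obtain D x where D: "A = down_set X D" "directed X D" "dconverges X D x" "\<forall>d\<in>D. spec_le X d x"
    using assms(2) unfolding top_ideals_def ideal_net_def by blast
  have "D \<subseteq> A"
    using D(1,2) spec_le_refl by (fastforce simp: down_set_def down_def directed_def)
  then show ?thesis
    using D(3) ideal_net_limit_eq_tsup(2)[OF assms(1) D(2-4)] D(1)
    unfolding dconverges_def by blast
qed

lemma spec_le_tsup:
  assumes "t0_space X" "A \<in> top_ideals X" "a \<in> A"
  shows "spec_le X a (tsup X A)"
  using is_tsup_tsup[OF assms(1,2)] assms(3) by (simp add: is_tsup_def)

lemma tsup_mono:
  assumes "t0_space X" "A \<in> top_ideals X" "B \<in> top_ideals X" "A \<subseteq> B"
  shows "spec_le X (tsup X A) (tsup X B)"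
proof -
  have "tsup X B \<in> topspace X" "\<forall>a\<in>A. spec_le X a (tsup X B)"
    using is_tsup_tsup[OF assms(1,3)] assms(4) by (auto simp: is_tsup_def)
  then show ?thesis
    using is_tsup_tsup[OF assms(1,2)] by (simp add: is_tsup_def)
qed

section \<open>The ideal space: continuity of suprema, specialization order, algebraicity\<close>

lemma ideal_open_CollectI:
  assumes "\<And>A. A \<in> top_ideals X \<Longrightarrow> P A \<longleftrightarrow> (\<exists>x\<in>topspace X. P (down X x) \<and> down X x \<subseteq> A)"
  shows "ideal_open X {A \<in> top_ideals X. P A}"
  unfolding ideal_open_def
proof (intro conjI ballI)
  fix A assume A: "A \<in> top_ideals X"
  have "A \<in> {A \<in> top_ideals X. P A} \<longleftrightarrow> P A" using A by simp
  also have "\<dots> \<longleftrightarrow> (\<exists>x\<in>topspace X. P (down X x) \<and> down X x \<subseteq> A)" by (rule assms[OF A])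
  also have "\<dots> \<longleftrightarrow> (\<exists>x\<in>topspace X. down X x \<in> {A \<in> top_ideals X. P A} \<and> down X x \<subseteq> A)"
    by (rule bex_cong) (simp_all add: down_in_top_ideals)
  finally show "A \<in> {A \<in> top_ideals X. P A} \<longleftrightarrow>
    (\<exists>x\<in>topspace X. down X x \<in> {A \<in> top_ideals X. P A} \<and> down X x \<subseteq> A)" .
qed simp

text \<open>Convergence of \<open>A\<close> to its supremum puts some \<open>a\<close> of
  \<open>A\<close> into \<open>V\<close>, and \<open>a\<close> is the supremum of
  \<open>down X a\<close>. Conversely, suprema are monotone and open sets are upper sets.\<close>

lemma continuous_map_tsup:
  assumes "t0_space X"
  shows "continuous_map (ideal_space X) X (tsup X)"
  unfolding continuous_map_def topspace_ideal_space openin_ideal_space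
proof (intro conjI allI impI)
  show "tsup X \<in> top_ideals X \<rightarrow> topspace X"
    using is_tsup_tsup[OF assms] by (auto simp: is_tsup_def)
  fix V assume V: "openin X V"
  have "tsup X A \<in> V \<longleftrightarrow> (\<exists>x\<in>topspace X. tsup X (down X x) \<in> V \<and> down X x \<subseteq> A)"
    if A: "A \<in> top_ideals X" for A
  proof
    assume "tsup X A \<in> V"
    then obtain a where a: "a \<in> A" "a \<in> V"
      using top_ideals_converge[OF assms A] V by (auto simp: dconverges_def)
    then show "\<exists>x\<in>topspace X. tsup X (down X x) \<in> V \<and> down X x \<subseteq> A"
      using top_ideals_lower[OF A a(1)] tsup_down[OF assms] by auto
  next
    assume "\<exists>x\<in>topspace X. tsup X (down X x) \<in> V \<and> down X x \<subseteq> A"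
    then obtain x where "x \<in> topspace X" "tsup X (down X x) \<in> V" "down X x \<subseteq> A"
      by blast
    then show "tsup X A \<in> V"
      using tsup_mono[OF assms down_in_top_ideals A] V unfolding spec_le_iff by blast
  qed
  then show "ideal_open X {A \<in> top_ideals X. tsup X A \<in> V}"
    by (rule ideal_open_CollectI)
qed

text \<open>The witness below \<open>A\<close> is \<open>down X a\<close>. These open sets separate
  ideals, force the specialization order to refine inclusion, and are the filters generated by
  principal ideals.\<close>

lemma openin_ideals_containing: "openin (ideal_space X) {A \<in> top_ideals X. a \<in> A}"
proof -
  have "a \<in> A \<longleftrightarrow> (\<exists>x\<in>topspace X. a \<in> down X x \<and> down X x \<subseteq> A)" if A: "A \<in> top_ideals X" for A
    using top_ideals_lower[OF A, of a] spec_le_refl[of a X] by (auto simp: down_def)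
  then show ?thesis
    unfolding openin_ideal_space by (rule ideal_open_CollectI)
qed

lemma spec_le_ideal_space:
  "spec_le (ideal_space X) A B \<longleftrightarrow> A \<in> top_ideals X \<and> B \<in> top_ideals X \<and> A \<subseteq> B"
proof (intro iffI conjI)
  assume AB: "spec_le (ideal_space X) A B"
  then show "A \<in> top_ideals X" "B \<in> top_ideals X"
    by (auto simp: spec_le_iff topspace_ideal_space)
  then show "A \<subseteq> B"
    using AB openin_ideals_containing[of X] unfolding spec_le_iff by blast
next
  assume AB: "A \<in> top_ideals X \<and> B \<in> top_ideals X \<and> A \<subseteq> B"
  \<comment> \<open>The principal ideal witnessing that \<open>A\<close> is in the open set lies
    below \<open>B\<close> as well.\<close>
  then have "B \<in> \<U>" if "ideal_open X \<U>" "A \<in> \<U>" for \<U>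
    using ideal_openD[OF that] ideal_openI[OF that(1)] by (metis subset_trans)
  then show "spec_le (ideal_space X) A B"
    using AB by (simp add: spec_le_iff topspace_ideal_space openin_ideal_space)
qed

lemma t0_space_ideal_space: "t0_space (ideal_space X)"
  unfolding t0_space_def topspace_ideal_space
proof (intro ballI impI)
  fix A B assume "A \<in> top_ideals X" "B \<in> top_ideals X" "A \<noteq> B"
  then obtain a where "a \<in> A \<longleftrightarrow> a \<notin> B" by blast
  then show "\<exists>\<U>. openin (ideal_space X) \<U> \<and> (A \<notin> \<U>) = (B \<in> \<U>)"
    using openin_ideals_containing[of X a] \<open>A \<in> top_ideals X\<close> \<open>B \<in> top_ideals X\<close> by blast
qed

lemma algebraic_space_ideal_space: "algebraic_space (ideal_space X)"
  unfolding algebraic_space_def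
proof (intro conjI allI impI t0_space_ideal_space)
  fix \<U> A assume A: "openin (ideal_space X) \<U> \<and> A \<in> \<U>"
  then have AI: "A \<in> top_ideals X"
    using openin_subset topspace_ideal_space by blast
  obtain x where x: "x \<in> topspace X" "down X x \<in> \<U>" "down X x \<subseteq> A"
    using A ideal_openD unfolding openin_ideal_space by metis
  \<comment> \<open>In this form the filter above \<open>down X x\<close> is visibly open, hence
    equal to its interior.\<close>
  have up: "up (ideal_space X) (down X x) = {B \<in> top_ideals X. x \<in> B}"
    using down_subset_iff[OF _ x(1)] down_in_top_ideals[OF x(1)]
    by (auto simp: up_def spec_le_ideal_space)
  then have "ideal_space X interior_of up (ideal_space X) (down X x) = up (ideal_space X) (down X x)"
    using openin_ideals_containing by (simp add: interior_of_eq)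
  moreover have "A \<in> up (ideal_space X) (down X x)"
    using up AI x(3) down_subset_iff[OF AI x(1)] by simp
  ultimately show "\<exists>B\<in>\<U>. A \<in> ideal_space X interior_of up (ideal_space X) B \<and>
      ideal_space X interior_of up (ideal_space X) B = up (ideal_space X) B"
    using x(2) by (intro bexI[of _ "down X x"]) auto
qed

section \<open>Way-below ideals and the adjunction\<close>

definition way_below :: "'a topology \<Rightarrow> 'a \<Rightarrow> 'a set"
  where "way_below X x = {y. x \<in> X interior_of (up X y)}"

lemma way_below_imp_spec_le: "y \<in> way_below X x \<Longrightarrow> spec_le X y x"
  using interior_of_subset[of X "up X y"] by (auto simp: way_below_def up_def)

lemma way_below_mono_left:
  assumes "spec_le X z y" "y \<in> way_below X x"
  shows "z \<in> way_below X x"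
proof -
  have "up X y \<subseteq> up X z"
    using spec_le_trans[OF assms(1)] by (auto simp: up_def)
  then show ?thesis
    using assms(2) interior_of_mono unfolding way_below_def by blast
qed

text \<open>Allows the set to serve as its own generating net when it is shown to be a topological
  ideal.\<close>

lemma down_set_way_below: "down_set X (way_below X x) = way_below X x"
proof
  show "down_set X (way_below X x) \<subseteq> way_below X x"
    using way_below_mono_left by (fastforce simp: down_set_def down_def)
  show "way_below X x \<subseteq> down_set X (way_below X x)"
  proof
    fix y assume y: "y \<in> way_below X x"
    then have "spec_le X y y"
      using way_below_imp_spec_le spec_le_refl unfolding spec_le_iff by metis
    then show "y \<in> down_set X (way_below X x)"
      using y by (auto simp: down_set_def down_def)
  qed
qed

lemma way_below_ideal:
  assumes "continuous_space X" "x \<in> topspace X"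
  shows "way_below X x \<in> top_ideals X" "tsup X (way_below X x) = x"
proof -
  have t0: "t0_space X" and
    approx: "\<And>U. openin X U \<Longrightarrow> x \<in> U \<Longrightarrow> \<exists>y\<in>U. y \<in> way_below X x"
    using assms(1) by (auto simp: continuous_space_def way_below_def)
  have "directed X (way_below X x)"
    unfolding directed_def
  proof (intro conjI ballI)
    show "way_below X x \<noteq> {}"
      using approx[OF openin_topspace assms(2)] by blast
    show "way_below X x \<subseteq> topspace X"
      using way_below_imp_spec_le by (fastforce simp: spec_le_iff)
    fix y z assume "y \<in> way_below X x" "z \<in> way_below X x"
    then have "x \<in> X interior_of up X y \<inter> X interior_of up X z"
      by (simp add: way_below_def)
    \<comment> \<open>The intersection is an open neighbourhood of \<open>x\<close>, so it contains
      a point way below \<open>x\<close>; lying in both interiors, that point is above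
      \<open>y\<close> and \<open>z\<close>.\<close>
    then obtain w where "w \<in> way_below X x" "w \<in> X interior_of up X y \<inter> X interior_of up X z"
      using approx[OF openin_Int[OF openin_interior_of openin_interior_of]] by blast
    then show "\<exists>w\<in>way_below X x. spec_le X y w \<and> spec_le X z w"
      using way_below_imp_spec_le by (intro bexI[of _ w]) (auto simp: way_below_def)
  qed
  moreover have "dconverges X (way_below X x) x"
    using assms(2) approx unfolding dconverges_def by blast
  moreover have "\<forall>y\<in>way_below X x. spec_le X y x"
    by (simp add: way_below_imp_spec_le)
  ultimately show "way_below X x \<in> top_ideals X" "tsup X (way_below X x) = x"
    using ideal_net_limit_eq_tsup[OF t0, of "way_below X x" x] by (simp_all add: down_set_way_below)
qed

text \<open>If \<open>y\<close> is way below \<open>x\<close>, the interior of \<open>up X y\<close>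
  is an open neighbourhood of \<open>x\<close>, hence of every point above \<open>x\<close>. An
  ideal converging to such a point meets it, so contains an element above \<open>y\<close> and thus
  \<open>y\<close> itself.\<close>

lemma way_below_adjoint:
  assumes "continuous_space X" "x \<in> topspace X" "A \<in> top_ideals X"
  shows "way_below X x \<subseteq> A \<longleftrightarrow> spec_le X x (tsup X A)"
proof
  have t0: "t0_space X" using assms(1) by (simp add: continuous_space_def)
  note W = way_below_ideal[OF assms(1,2)]
  show "spec_le X x (tsup X A)" if "way_below X x \<subseteq> A"
    using tsup_mono[OF t0 W(1) assms(3) that] W(2) by simp
  assume le: "spec_le X x (tsup X A)"
  show "way_below X x \<subseteq> A"
  proof
    fix y assume "y \<in> way_below X x"
    then have "tsup X A \<in> X interior_of up X y"
      using le unfolding way_below_def spec_le_iff by simp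
    then have "A \<inter> X interior_of up X y \<noteq> {}"
      using top_ideals_converge[OF t0 assms(3)] openin_interior_of unfolding dconverges_def by metis
    then obtain a where a: "a \<in> A" "a \<in> X interior_of up X y"
      by blast
    then have "y \<in> down X a"
      using interior_of_subset[of X "up X y"] by (auto simp: up_def down_def)
    then show "y \<in> A"
      using top_ideals_lower(2)[OF assms(3) a(1)] by blast
  qed
qed

lemma continuous_map_way_below:
  assumes "continuous_space X"
  shows "continuous_map X (ideal_space X) (way_below X)"
  unfolding continuous_map_def topspace_ideal_space openin_ideal_space
proof (intro conjI allI impI)
  show "way_below X \<in> topspace X \<rightarrow> top_ideals X"
    using way_below_ideal(1)[OF assms] by blast
  fix \<U> assume U: "ideal_open X \<U>"
  \<comment> \<open>An open set of ideals contains \<open>way_below X x\<close> exactly when it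
    contains \<open>down X z\<close> for some \<open>z\<close> way below \<open>x\<close>, that is,
    with \<open>x\<close> in the interior of \<open>up X z\<close>.\<close>
  have "{x \<in> topspace X. way_below X x \<in> \<U>} =
      (\<Union>z\<in>{z \<in> topspace X. down X z \<in> \<U>}. X interior_of up X z)" (is "?L = ?R")
  proof (rule set_eqI)
    fix x
    show "x \<in> ?L \<longleftrightarrow> x \<in> ?R"
    proof (cases "x \<in> topspace X")
      case True
      note W = way_below_ideal(1)[OF assms True]
      have "way_below X x \<in> \<U> \<longleftrightarrow> (\<exists>z\<in>topspace X. down X z \<in> \<U> \<and> down X z \<subseteq> way_below X x)"
        using U W by (simp add: ideal_open_def)
      then show ?thesis
        using True down_subset_iff[OF W] by (auto simp: way_below_def)
    next
      case False
      then show ?thesis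
        using interior_of_subset_topspace[of X] by blast
    qed
  qed
  then show "openin X {x \<in> topspace X. way_below X x \<in> \<U>}"
    by auto
qed

section \<open>From adjoints to retracts and back to continuity\<close>

lemma tsup_lower_adjoint:
  assumes "t0_space X" "x \<in> topspace X" "f x \<in> top_ideals X"
    and adj: "\<And>A. A \<in> top_ideals X \<Longrightarrow> f x \<subseteq> A \<longleftrightarrow> spec_le X x (tsup X A)"
  shows "tsup X (f x) = x"
proof (rule spec_le_antisym[OF assms(1)])
  \<comment> \<open>The adjunction is tested at \<open>down X x\<close>, whose supremum is
    \<open>x\<close>; testing it at \<open>f x\<close> gives the other inequality.\<close>
  have "f x \<subseteq> down X x"
    using adj[OF down_in_top_ideals[OF assms(2)]] tsup_down[OF assms(1,2)] spec_le_refl[OF assms(2)]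
    by simp
  then show "spec_le X (tsup X (f x)) x"
    using tsup_mono[OF assms(1,3) down_in_top_ideals[OF assms(2)]] tsup_down[OF assms(1,2)] by simp
  show "spec_le X x (tsup X (f x))"
    using adj[OF assms(3)] by simp
qed

lemma algebraic_imp_continuous_space: "algebraic_space X \<Longrightarrow> continuous_space X"
  unfolding algebraic_space_def continuous_space_def by blast

lemma continuous_space_retract:
  assumes "t0_space X" "continuous_space Y" "continuous_map X Y g" "continuous_map Y X h"
    and hg: "\<And>x. x \<in> topspace X \<Longrightarrow> h (g x) = x"
  shows "continuous_space X"
  unfolding continuous_space_def
proof (intro conjI allI impI assms(1))
  fix U x assume "openin X U \<and> x \<in> U"
  then have U: "openin X U" "x \<in> U" and x: "x \<in> topspace X"
    using openin_subset by blast+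
  have "openin Y {y \<in> topspace Y. h y \<in> U}"
    by (rule openin_continuous_map_preimage[OF assms(4) U(1)])
  moreover have "g x \<in> {y \<in> topspace Y. h y \<in> U}"
    using U x hg continuous_map_image_subset_topspace[OF assms(3)] by auto
  ultimately obtain y where y: "h y \<in> U" "g x \<in> Y interior_of up Y y"
    using assms(2) unfolding continuous_space_def by blast
  \<comment> \<open>For \<open>z\<close> in \<open>W\<close>, \<open>y\<close> is below
    \<open>g z\<close>; the monotone map \<open>h\<close> then gives \<open>h y\<close> below
    \<open>h (g z) = z\<close>. So \<open>W\<close> is an open neighbourhood of \<open>x\<close>
    inside \<open>up X (h y)\<close>.\<close>
  define W where "W = {z \<in> topspace X. g z \<in> Y interior_of up Y y}"
  have "openin X W"
    unfolding W_def by (rule openin_continuous_map_preimage[OF assms(3) openin_interior_of])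
  moreover have "W \<subseteq> up X (h y)"
  proof
    fix z assume "z \<in> W"
    then have "z \<in> topspace X" "spec_le Y y (g z)"
      using interior_of_subset[of Y "up Y y"] by (auto simp: W_def up_def)
    then show "z \<in> up X (h y)"
      using spec_le_continuous_map[OF assms(4)] hg by (fastforce simp: up_def)
  qed
  moreover have "x \<in> W"
    using x y(2) by (simp add: W_def)
  ultimately have "x \<in> X interior_of up X (h y)"
    using interior_of_maximal by blast
  then show "\<exists>y\<in>U. x \<in> X interior_of up X y"
    using y(1) by blast
qed

text \<open>HOL does not quantify over types, so the retract condition is split: the ideal space
  provides a witness of type \<open>'a set topology\<close>, and the last conjunct covers an
  algebraic space over an arbitrary type \<open>'b\<close>.\<close>

theorem theorem3p21:
  fixes X :: "'a topology"
  assumes "t0_space X"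
  shows
    "(continuous_space X \<longleftrightarrow>
        (\<exists>f. continuous_map X (ideal_space X) f \<and>
             (\<forall>x\<in>topspace X. \<forall>A\<in>top_ideals X. f x \<subseteq> A \<longleftrightarrow> spec_le X x (tsup X A)))) \<and>
     (continuous_space X \<longleftrightarrow>
        (\<exists>(Y :: 'a set topology) g h.
             algebraic_space Y \<and> continuous_map X Y g \<and> continuous_map Y X h \<and>
             (\<forall>x\<in>topspace X. h (g x) = x))) \<and>
     ((\<exists>(Y :: 'b topology) g h.
             algebraic_space Y \<and> continuous_map X Y g \<and> continuous_map Y X h \<and>
             (\<forall>x\<in>topspace X. h (g x) = x)) \<longrightarrow> continuous_space X)"
    (is "(?C \<longleftrightarrow> ?Adj) \<and> (?C \<longleftrightarrow> ?Ret) \<and> (?Ret' \<longrightarrow> ?C)")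
proof -
  have "?Adj" if ?C
    using continuous_map_way_below[OF that] way_below_adjoint[OF that]
    by (intro exI[of _ "way_below X"]) blast
  moreover have "?Ret" if ex: ?Adj
  proof -
    obtain f where f: "continuous_map X (ideal_space X) f"
      and adj: "\<forall>x\<in>topspace X. \<forall>A\<in>top_ideals X. f x \<subseteq> A \<longleftrightarrow> spec_le X x (tsup X A)"
      using ex by (elim exE conjE)
    have "f x \<in> top_ideals X" if "x \<in> topspace X" for x
      using continuous_map_image_subset_topspace[OF f] that topspace_ideal_space by blast
    then have "\<forall>x\<in>topspace X. tsup X (f x) = x"
      using tsup_lower_adjoint[OF assms] adj by simp
    then show ?thesis
      using algebraic_space_ideal_space f continuous_map_tsup[OF assms] by blast
  qed
  moreover have "?C" if ?Ret
    using that continuous_space_retract[OF assms] algebraic_imp_continuous_space by metis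
  moreover have "?C" if ?Ret'
    using that continuous_space_retract[OF assms] algebraic_imp_continuous_space by metis
  ultimately show ?thesis by argo
qed

end
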